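(* Let $k$ be an infinite field. In any codimension $c\ge 3$, every $\mathrm{CI}$-sequence is an $\mathrm{ACI}$-sequence.
   Context: $k$ is an infinite field and $R=k[x_1,\ldots,x_c]$, $c\ge 3$, is the standard graded polynomial ring; only homogeneous ideals are considered. A standard graded artinian algebra $R/I$ of codimension $c$ is a complete intersection algebra if $I$ is generated by a regular sequence of $c$ forms. It is an almost complete intersection algebra if $I$ is minimally generated by exactly $c+1$ elements. The Hilbert function of a standard graded algebra gives the dimensions over $k$ of its graded components. A sequence of positive integers $H$ is called a $\mathrm{CI}$-sequence if it is the Hilbert function of a standard graded artinian complete intersection algebra. It is called an $\mathrm{ACI}$-sequence if it is the Hilbert function of a standard graded artinian almost complete intersection algebra. *)

theory Defs
  imports Complex_Main "HOL-Library.Poly_Mapping" "HOL-Library.Cardinality"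
begin

section \<open>Polynomial rings, forms and ideals\<close>

text \<open>
  The polynomial ring over \<open>'k\<close> in finitely many variables indexed by \<open>'n\<close>: a monomial
  is an exponent vector, a polynomial is a finitely supported coefficient function, and
  multiplication is convolution. The number of variables is \<open>CARD('n)\<close>.
\<close>

type_synonym ('n, 'k) mpoly = "('n \<Rightarrow>\<^sub>0 nat) \<Rightarrow>\<^sub>0 'k"

global_interpretation ideal: module "(*) :: 'a::comm_ring_1 \<Rightarrow> 'a \<Rightarrow> 'a"
  by unfold_locales (simp_all add: algebra_simps)

text \<open>
  An ideal is a submodule of the ring viewed as a module over itself, so \<open>ideal.subspace I\<close>
  says that \<open>I\<close> is an ideal and \<open>ideal.span G\<close> is the ideal generated by \<open>G\<close>.
\<close>

definition pscale :: "'k::field \<Rightarrow> ('n, 'k) mpoly \<Rightarrow> ('n, 'k) mpoly"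
  where "pscale a p = Poly_Mapping.single 0 a * p"

global_interpretation poly: vector_space "pscale :: 'k::field \<Rightarrow> ('n, 'k) mpoly \<Rightarrow> ('n, 'k) mpoly"
proof
  fix a b :: 'k and p q :: "('n, 'k) mpoly"
  show "pscale a (p + q) = pscale a p + pscale a q"
    by (simp add: pscale_def distrib_left)
  show "pscale (a + b) p = pscale a p + pscale b p"
    by (simp add: pscale_def single_add distrib_right)
  show "pscale a (pscale b p) = pscale (a * b) p"
    by (simp add: pscale_def mult_single flip: mult.assoc)
  show "pscale 1 p = p"
    by (simp add: pscale_def)
qed

definition mdeg :: "('n::finite \<Rightarrow>\<^sub>0 nat) \<Rightarrow> nat"
  where "mdeg m = (\<Sum>i\<in>UNIV. Poly_Mapping.lookup m i)"

definition forms :: "nat \<Rightarrow> ('n::finite, 'k::field) mpoly set"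
  where "forms d = {p. \<forall>m\<in>Poly_Mapping.keys p. mdeg m = d}"

definition is_form :: "('n::finite, 'k::field) mpoly \<Rightarrow> bool"
  where "is_form p \<longleftrightarrow> (\<exists>d. p \<in> forms d)"


section \<open>Artinian quotients and Hilbert functions\<close>

text \<open>
  The ideals of \<open>R/I\<close> are identified with the ideals of \<open>R\<close> containing \<open>I\<close>; the condition
  below is the descending chain condition on them.
\<close>

definition artinian_quotient :: "'a::comm_ring_1 set \<Rightarrow> bool"
  where "artinian_quotient I \<longleftrightarrow>
    (\<forall>J :: nat \<Rightarrow> 'a set.
       (\<forall>i. ideal.subspace (J i) \<and> I \<subseteq> J i \<and> J (Suc i) \<subseteq> J i) \<longrightarrow>
       (\<exists>N. \<forall>i\<ge>N. J i = J N))"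

text \<open>
  \<open>B\<close> consists of forms of degree \<open>d\<close> whose residue classes are a \<open>k\<close>-basis of the degree
  \<open>d\<close> component of \<open>R/I\<close>, that is, of the image of \<open>forms d\<close> in \<open>R/I\<close>. (The residue classes
  of distinct elements of \<open>B\<close> are then distinct, so \<open>card B\<close> is the size of that basis.)
\<close>

definition component_basis ::
    "('n::finite, 'k::field) mpoly set \<Rightarrow> nat \<Rightarrow> ('n, 'k) mpoly set \<Rightarrow> bool"
  where "component_basis I d B \<longleftrightarrow>
    finite B \<and> B \<subseteq> forms d \<and>
    (\<forall>a. (\<Sum>b\<in>B. pscale (a b) b) \<in> I \<longrightarrow> (\<forall>b\<in>B. a b = 0)) \<and>
    (\<forall>p\<in>forms d. \<exists>a. p - (\<Sum>b\<in>B. pscale (a b) b) \<in> I)"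

definition hilbert_function :: "('n::finite, 'k::field) mpoly set \<Rightarrow> nat \<Rightarrow> nat"
  where "hilbert_function I d = card (SOME B. component_basis I d B)"

text \<open>
  For artinian quotients the Hilbert function is written as the finite list of its nonzero
  values.
\<close>

definition has_hilbert_sequence :: "('n::finite, 'k::field) mpoly set \<Rightarrow> nat list \<Rightarrow> bool"
  where "has_hilbert_sequence I H \<longleftrightarrow>
    (\<forall>d. hilbert_function I d = (if d < length H then H ! d else 0))"


section \<open>Complete and almost complete intersections\<close>

definition regular_sequence :: "'a::comm_ring_1 list \<Rightarrow> bool"
  where "regular_sequence fs \<longleftrightarrow>
    ideal.span (set fs) \<noteq> UNIV \<and>
    (\<forall>i<length fs. \<forall>g. g * fs ! i \<in> ideal.span (set (take i fs)) \<longrightarrow>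
       g \<in> ideal.span (set (take i fs)))"

text \<open>
  A standard graded artinian algebra of codimension \<open>c\<close> is presented as \<open>R/I\<close> with \<open>R\<close> in
  \<open>c\<close> variables and no superfluous variable: its degree one component has dimension \<open>c\<close>, in
  other words \<open>I\<close> contains no nonzero linear form. Without this requirement the sequence \<open>(1)\<close>
  would be the Hilbert function of a complete intersection in every number of variables, while
  the maximal ideal is never minimally generated by \<open>c + 1\<close> forms.
\<close>

definition artinian_algebra_full_codim :: "('n::finite, 'k::field) mpoly set \<Rightarrow> bool"
  where "artinian_algebra_full_codim I \<longleftrightarrow>
    artinian_quotient I \<and> hilbert_function I 1 = CARD('n)"

definition complete_intersection :: "('n::finite, 'k::field) mpoly set \<Rightarrow> bool"
  where "complete_intersection I \<longleftrightarrow>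
    artinian_algebra_full_codim I \<and>
    (\<exists>fs. length fs = CARD('n) \<and> (\<forall>f\<in>set fs. is_form f) \<and> regular_sequence fs \<and>
       I = ideal.span (set fs))"

definition almost_complete_intersection :: "('n::finite, 'k::field) mpoly set \<Rightarrow> bool"
  where "almost_complete_intersection I \<longleftrightarrow>
    artinian_algebra_full_codim I \<and>
    (\<exists>G. finite G \<and> card G = CARD('n) + 1 \<and> (\<forall>g\<in>G. is_form g) \<and> I = ideal.span G \<and>
       (\<forall>G'. G' \<subset> G \<longrightarrow> ideal.span G' \<noteq> I))"

text \<open>
  The type arguments fix the ground field \<open>'k\<close> and the codimension \<open>c = CARD('n)\<close>.
\<close>

definition CI_sequence :: "'k::field itself \<Rightarrow> 'n::finite itself \<Rightarrow> nat list \<Rightarrow> bool"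
  where "CI_sequence _ _ H \<longleftrightarrow>
    (\<forall>h\<in>set H. h > 0) \<and>
    (\<exists>I :: ('n, 'k) mpoly set. complete_intersection I \<and> has_hilbert_sequence I H)"

definition ACI_sequence :: "'k::field itself \<Rightarrow> 'n::finite itself \<Rightarrow> nat list \<Rightarrow> bool"
  where "ACI_sequence _ _ H \<longleftrightarrow>
    (\<forall>h\<in>set H. h > 0) \<and>
    (\<exists>I :: ('n, 'k) mpoly set. almost_complete_intersection I \<and> has_hilbert_sequence I H)"


section \<open>The Hilbert function is well defined\<close>

lemma ideal_imp_poly_subspace:
  assumes "ideal.subspace I"
  shows "poly.subspace I"
  unfolding poly.subspace_def pscale_def
  by (intro conjI ballI allI ideal.subspace_0 ideal.subspace_add ideal.subspace_scale assms)

lemma subspace_forms: "poly.subspace (forms d :: ('n::finite, 'k::field) mpoly set)"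
proof (unfold poly.subspace_def, intro conjI ballI allI)
  fix p q :: "('n, 'k) mpoly" and a
  assume p: "p \<in> forms d"
  have "Poly_Mapping.keys (pscale a p) \<subseteq> Poly_Mapping.keys p"
  proof
    fix m assume "m \<in> Poly_Mapping.keys (pscale a p)"
    then obtain x y where "m = x + y" "x \<in> Poly_Mapping.keys (Poly_Mapping.single 0 a)"
        "y \<in> Poly_Mapping.keys p"
      using keys_mult[of "Poly_Mapping.single 0 a" p] unfolding pscale_def by blast
    then show "m \<in> Poly_Mapping.keys p" by (cases "a = 0") simp_all
  qed
  then show "pscale a p \<in> forms d" using p by (auto simp: forms_def)
  assume q: "q \<in> forms d"
  have "mdeg m = d" if "m \<in> Poly_Mapping.keys (p + q)" for m
  proof -
    have "m \<in> Poly_Mapping.keys p \<or> m \<in> Poly_Mapping.keys q"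
      using that Poly_Mapping.keys_add[of p q] by blast
    then show ?thesis using p q unfolding forms_def by blast
  qed
  then show "p + q \<in> forms d" by (simp add: forms_def)
qed (simp add: forms_def)

lemma finite_mdeg: "finite {m :: 'n::finite \<Rightarrow>\<^sub>0 nat. mdeg m = d}"
proof (rule finite_imageD)
  show "inj_on Poly_Mapping.lookup {m :: 'n \<Rightarrow>\<^sub>0 nat. mdeg m = d}"
    by (simp add: inj_on_def lookup_inject)
  have "Poly_Mapping.lookup m i \<le> d" if "mdeg m = d" for m :: "'n \<Rightarrow>\<^sub>0 nat" and i
    using that member_le_sum[of i UNIV "Poly_Mapping.lookup m"] by (simp add: mdeg_def)
  then have "Poly_Mapping.lookup ` {m :: 'n \<Rightarrow>\<^sub>0 nat. mdeg m = d}
      \<subseteq> {f. \<forall>i. (i \<in> UNIV \<longrightarrow> f i \<in> {..d}) \<and> (i \<notin> UNIV \<longrightarrow> f i = 0)}"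
    by auto
  then show "finite (Poly_Mapping.lookup ` {m :: 'n \<Rightarrow>\<^sub>0 nat. mdeg m = d})"
    by (rule finite_subset) (rule finite_set_of_finite_funs; simp)
qed

lemma forms_subset_span:
  "(forms d :: ('n::finite, 'k::field) mpoly set)
     \<subseteq> poly.span ((\<lambda>m. Poly_Mapping.single m 1) ` {m. mdeg m = d})"
proof
  fix p :: "('n, 'k) mpoly" assume p: "p \<in> forms d"
  have "p = (\<Sum>m\<in>Poly_Mapping.keys p. pscale (Poly_Mapping.lookup p m) (Poly_Mapping.single m 1))"
    by (rule poly_mapping_eqI)
      (auto simp: lookup_sum pscale_def mult_single lookup_single when_def in_keys_iff)
  moreover have "\<dots> \<in> poly.span ((\<lambda>m. Poly_Mapping.single m 1) ` {m. mdeg m = d})"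
    using p by (intro poly.span_sum poly.span_scale poly.span_base) (auto simp: forms_def)
  ultimately show "p \<in> poly.span ((\<lambda>m. Poly_Mapping.single m 1) ` {m. mdeg m = d})"
    by simp
qed

lemma finite_independent_forms:
  assumes "poly.independent B" "B \<subseteq> forms d"
  shows "finite B"
proof -
  have "B \<subseteq> poly.span ((\<lambda>m. Poly_Mapping.single m 1) ` {m. mdeg m = d})"
    using assms(2) forms_subset_span by (rule subset_trans)
  from poly.independent_span_bound[OF finite_imageI[OF finite_mdeg] assms(1) this]
  show ?thesis ..
qed

lemma component_basis_extend:
  assumes I: "ideal.subspace I" and B: "component_basis I d B"
    and C: "C \<subseteq> I \<inter> forms d" "poly.independent C" "I \<inter> forms d \<subseteq> poly.span C"
  shows "B \<inter> C = {} \<and> poly.independent (B \<union> C) \<and> forms d \<subseteq> poly.span (B \<union> C)"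
proof -
  note sI = ideal_imp_poly_subspace[OF I]
  have finB: "finite B" and Bd: "B \<subseteq> forms d"
    and ind: "\<And>a b. (\<Sum>b\<in>B. pscale (a b) b) \<in> I \<Longrightarrow> b \<in> B \<Longrightarrow> a b = 0"
    and spn: "\<And>p. p \<in> forms d \<Longrightarrow> \<exists>a. p - (\<Sum>b\<in>B. pscale (a b) b) \<in> I"
    using B by (simp_all add: component_basis_def)
  have finC: "finite C" using finite_independent_forms[OF C(2), of d] C(1) by simp
  have disj: "B \<inter> C = {}"
  proof (rule ccontr)
    assume "B \<inter> C \<noteq> {}"
    then obtain b where b: "b \<in> B" "b \<in> C" by blast
    have "(\<Sum>x\<in>B. pscale (if x = b then 1 else 0) x) = b"
      using b finB by (subst sum.remove[of _ b]) auto
    with ind[of "\<lambda>x. if x = b then 1 else 0" b] b C(1) show False by auto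
  qed
  have "poly.independent (B \<union> C)"
  proof (rule poly.independent_if_scalars_zero)
    show "finite (B \<union> C)" using finB finC by simp
    fix f x assume s: "(\<Sum>x\<in>B \<union> C. pscale (f x) x) = 0" and x: "x \<in> B \<union> C"
    have e: "(\<Sum>x\<in>B. pscale (f x) x) + (\<Sum>x\<in>C. pscale (f x) x) = 0"
      using s by (simp add: sum.union_disjoint finB finC disj)
    have "(\<Sum>x\<in>C. pscale (- f x) x) \<in> I"
      using C(1) by (intro poly.subspace_sum[OF sI] poly.subspace_scale[OF sI]) auto
    moreover have "(\<Sum>x\<in>B. pscale (f x) x) = (\<Sum>x\<in>C. pscale (- f x) x)"
      using e by (simp add: sum_negf eq_neg_iff_add_eq_0)
    ultimately have fB: "f b = 0" if "b \<in> B" for b using ind that by simp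
    then have "(\<Sum>x\<in>C. pscale (f x) x) = 0" using e by simp
    then have "f b = 0" if "b \<in> C" for b
      using poly.independentD[OF C(2) finC order_refl] that by blast
    with fB x show "f x = 0" by blast
  qed
  moreover have "p \<in> poly.span (B \<union> C)" if p: "p \<in> forms d" for p
  proof -
    obtain a where a: "p - (\<Sum>b\<in>B. pscale (a b) b) \<in> I" using spn p by blast
    moreover have "p - (\<Sum>b\<in>B. pscale (a b) b) \<in> forms d"
      using p Bd by (intro poly.subspace_diff poly.subspace_sum poly.subspace_scale subspace_forms) auto
    ultimately have "p - (\<Sum>b\<in>B. pscale (a b) b) \<in> poly.span (B \<union> C)"
      using C(3) poly.span_mono[of C "B \<union> C"] by blast
    moreover have "(\<Sum>b\<in>B. pscale (a b) b) \<in> poly.span (B \<union> C)"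
      by (intro poly.span_sum poly.span_scale poly.span_base) auto
    ultimately show ?thesis using poly.span_add by fastforce
  qed
  ultimately show ?thesis using disj by blast
qed

lemma component_basis_exists:
  fixes I :: "('n::finite, 'k::field) mpoly set"
  assumes I: "ideal.subspace I"
  shows "\<exists>B. component_basis I d B"
proof -
  note sI = ideal_imp_poly_subspace[OF I]
  obtain C where C: "C \<subseteq> I \<inter> forms d" "poly.independent C" "I \<inter> forms d \<subseteq> poly.span C"
    using poly.maximal_independent_subset by blast
  obtain D where D: "C \<subseteq> D" "D \<subseteq> forms d" "poly.independent D" "forms d \<subseteq> poly.span D"
    using poly.maximal_independent_subset_extend[of C "forms d"] C by blast
  have fin: "finite D" by (rule finite_independent_forms[OF D(3,2)])
  then have finC: "finite C" using D(1) finite_subset by blast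
  have "component_basis I d (D - C)"
    unfolding component_basis_def
  proof (intro conjI allI impI ballI)
    fix a b assume a: "(\<Sum>b\<in>D - C. pscale (a b) b) \<in> I" and b: "b \<in> D - C"
    have "(\<Sum>b\<in>D - C. pscale (a b) b) \<in> forms d"
      using D by (intro poly.subspace_sum poly.subspace_scale subspace_forms) auto
    then have "(\<Sum>b\<in>D - C. pscale (a b) b) \<in> poly.span C" using a C by blast
    then obtain u where u: "(\<Sum>b\<in>D - C. pscale (a b) b) = (\<Sum>b\<in>C. pscale (u b) b)"
      using poly.span_finite[OF finC] by auto
    define f where "f x = (if x \<in> C then - u x else a x)" for x
    have "(\<Sum>x\<in>D. pscale (f x) x) = (\<Sum>x\<in>D - C. pscale (f x) x) + (\<Sum>x\<in>C. pscale (f x) x)"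
      using fin D(1) by (simp add: sum.subset_diff)
    also have "\<dots> = 0" by (simp add: f_def u sum_negf)
    finally have "f b = 0" using poly.independentD[OF D(3) fin order_refl] b by blast
    then show "a b = 0" using b by (simp add: f_def)
  next
    fix p :: "('n, 'k) mpoly" assume "p \<in> forms d"
    then obtain u where u: "p = (\<Sum>b\<in>D. pscale (u b) b)"
      using D(4) poly.span_finite[OF fin] by auto
    have "p - (\<Sum>b\<in>D - C. pscale (u b) b) = (\<Sum>b\<in>C. pscale (u b) b)"
      unfolding u using fin D(1) by (simp add: sum.subset_diff)
    also have "\<dots> \<in> I"
      using C(1) by (intro poly.subspace_sum[OF sI] poly.subspace_scale[OF sI]) auto
    finally show "\<exists>a. p - (\<Sum>b\<in>D - C. pscale (a b) b) \<in> I" by blast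
  qed (use fin D in auto)
  then show ?thesis by blast
qed

lemma card_component_basis:
  fixes I :: "('n::finite, 'k::field) mpoly set"
  assumes I: "ideal.subspace I" and B: "component_basis I d B"
  shows "card B + poly.dim (I \<inter> forms d) = poly.dim (forms d :: ('n, 'k) mpoly set)"
proof -
  obtain C where C: "C \<subseteq> I \<inter> forms d" "poly.independent C" "I \<inter> forms d \<subseteq> poly.span C"
    using poly.maximal_independent_subset by blast
  note e = component_basis_extend[OF I B C]
  have "finite B" "B \<subseteq> forms d" using B by (auto simp: component_basis_def)
  moreover have "finite C" using finite_independent_forms[OF C(2), of d] C(1) by simp
  ultimately have "card B + card C = card (B \<union> C)" using e by (simp add: card_Un_disjoint)
  also have "\<dots> = poly.dim (forms d :: ('n, 'k) mpoly set)"
    using e C \<open>B \<subseteq> forms d\<close> by (intro poly.basis_card_eq_dim; blast)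
  finally show ?thesis using poly.basis_card_eq_dim[OF C(1,3,2)] by simp
qed

lemma hilbert_function_eq_card:
  assumes "ideal.subspace I" and "component_basis I d B"
  shows "hilbert_function I d = card B"
proof -
  have "component_basis I d (SOME B. component_basis I d B)"
    using assms(2) by (rule someI)
  then show ?thesis
    using card_component_basis[OF assms(1)] assms(2) unfolding hilbert_function_def
    by (metis add_right_cancel)
qed

lemma hilbert_function_eq_dim:
  fixes I :: "('n::finite, 'k::field) mpoly set"
  assumes "ideal.subspace I"
  shows "hilbert_function I d =
    poly.dim (forms d :: ('n, 'k) mpoly set) - poly.dim (I \<inter> forms d)"
proof -
  obtain B where B: "component_basis I d B" using component_basis_exists[OF assms] by blast
  show ?thesis
    using hilbert_function_eq_card[OF assms B] card_component_basis[OF assms B] by simp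
qed

end

theory Submission
  imports Defs
begin

text \<open>
  The Hilbert function of a complete intersection depends only on the degrees \<open>D i\<close> of its
  generators: if \<open>f\<close> is a form of degree \<open>d\<close> that is a nonzerodivisor modulo a homogeneous
  ideal \<open>I\<close>, the exact sequence
  \<open>0 \<longrightarrow> (R/I)(-d) \<longrightarrow> R/I \<longrightarrow> R/(I + (f)) \<longrightarrow> 0\<close> gives
  \<open>HF(I + (f), t) = HF(I, t) - HF(I, t - d)\<close> (\<open>hilbert_function_insert\<close>). The numbers of
  monomials whose exponents at a set \<open>S\<close> of variables lie below \<open>D\<close> satisfy the same
  recursion when \<open>S\<close> grows (\<open>card_box_monomials_insert\<close>), so the Hilbert function of the
  complete intersection in degree \<open>t\<close> is the number of monomials of degree \<open>t\<close> in the box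
  \<open>\<Prod>i. {0..<D i}\<close>, the value for the ideal of the pure powers \<open>x\<^sub>i ^ D i\<close>.

  Index the degrees by the variables and choose two variables \<open>x\<close>, \<open>y\<close> of degrees
  \<open>a = D x \<le> b = D y\<close>. As the quotient has full codimension, all degrees are at least \<open>2\<close>.
  In \<open>k[x, y]\<close>, the ideal \<open>(x^a, x^(a-1) y^(b+1-a), y^(b+1))\<close> has the same
  Hilbert function as \<open>(x^a, y^b)\<close>: in the passage from the box to the new set of standard
  monomials, the monomials \<open>x^(a-1) y^(b+1-a+i)\<close> with \<open>i < a - 1\<close> are lost and the
  monomials \<open>x^i y^b\<close> of the same degrees are gained (\<open>card_standard_monomials_aci\<close>). With
  the pure powers of the other variables added, this is an ideal with the required Hilbert
  function. It is generated by \<open>c + 1\<close> monomials none of which divides another, hence minimally,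
  and it is artinian because its Hilbert function is eventually zero.
\<close>

section \<open>Homogeneous components\<close>

definition hom_component :: "nat \<Rightarrow> ('n::finite, 'k::field) mpoly \<Rightarrow> ('n, 'k) mpoly" where
  "hom_component t p =
    (\<Sum>m\<in>{m \<in> Poly_Mapping.keys p. mdeg m = t}. Poly_Mapping.single m (Poly_Mapping.lookup p m))"

lemma lookup_hom_component:
  "Poly_Mapping.lookup (hom_component t p) m = (if mdeg m = t then Poly_Mapping.lookup p m else 0)"
proof -
  have "Poly_Mapping.lookup (hom_component t p) m =
      (\<Sum>m'\<in>{m \<in> Poly_Mapping.keys p. mdeg m = t}. if m' = m then Poly_Mapping.lookup p m' else 0)"
    by (simp add: hom_component_def lookup_sum lookup_single when_def)
  also have "\<dots> = (if mdeg m = t then Poly_Mapping.lookup p m else 0)"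
    by (auto simp: in_keys_iff)
  finally show ?thesis .
qed

lemma hom_component_add: "hom_component t (p + q) = hom_component t p + hom_component t q"
  by (rule poly_mapping_eqI) (simp add: lookup_hom_component lookup_add)

lemma hom_component_form: "p \<in> forms t \<Longrightarrow> hom_component t p = p"
  by (rule poly_mapping_eqI) (auto simp: lookup_hom_component forms_def in_keys_iff)

lemma hom_component_in_forms: "hom_component t p \<in> forms t"
  by (auto simp: forms_def in_keys_iff lookup_hom_component split: if_splits)

lemma hom_component_eq_0: "\<forall>m\<in>Poly_Mapping.keys p. mdeg m \<noteq> t \<Longrightarrow> hom_component t p = 0"
  by (rule poly_mapping_eqI) (auto simp: lookup_hom_component in_keys_iff)

lemma mdeg_add: "mdeg (u + v) = mdeg u + mdeg v"
  by (simp add: mdeg_def lookup_add sum.distrib)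

lemma mult_in_forms:
  assumes "p \<in> forms a" "q \<in> forms b"
  shows "p * q \<in> forms (a + b)"
  using assms keys_mult[of p q] by (force simp: forms_def mdeg_add)

text \<open>
  The part of \<open>g\<close> outside degree \<open>t - d\<close> contributes to \<open>g * f\<close> only outside degree \<open>t\<close>.
\<close>

lemma hom_component_mult_form:
  assumes f: "f \<in> forms d"
  shows "hom_component t (g * f) = (if d \<le> t then hom_component (t - d) g * f else 0)"
proof (cases "d \<le> t")
  case False
  have "mdeg m \<noteq> t" if "m \<in> Poly_Mapping.keys (g * f)" for m
    using that keys_mult[of g f] f False by (force simp: forms_def mdeg_add)
  then show ?thesis using False by (simp add: hom_component_eq_0)
next
  case True
  define h where "h = g - hom_component (t - d) g"
  have g: "g = hom_component (t - d) g + h" by (simp add: h_def)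
  have h: "mdeg m \<noteq> t - d" if "m \<in> Poly_Mapping.keys h" for m
    using that by (auto simp: h_def in_keys_iff lookup_minus lookup_hom_component)
  have "mdeg m \<noteq> t" if "m \<in> Poly_Mapping.keys (h * f)" for m
    using that keys_mult[of h f] f h by (force simp: forms_def mdeg_add)
  then have "hom_component t (h * f) = 0" by (simp add: hom_component_eq_0)
  moreover have "hom_component t (hom_component (t - d) g * f) = hom_component (t - d) g * f"
    using mult_in_forms[OF hom_component_in_forms f, of "t - d" g] True
    by (simp add: hom_component_form)
  ultimately show ?thesis
    using True by (subst g) (simp add: distrib_right hom_component_add)
qed

lemma hom_component_span:
  assumes S: "\<forall>f\<in>S. is_form f" and p: "p \<in> ideal.span S"
  shows "hom_component t p \<in> ideal.span S"
  using p
proof (induction rule: ideal.span_induct_alt)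
  case base
  show ?case by (simp add: hom_component_eq_0 ideal.span_zero)
next
  case (step c x y)
  obtain d where "x \<in> forms d" using S step(1) by (auto simp: is_form_def)
  then have "hom_component t (c * x) \<in> ideal.span S"
    using step(1) by (simp add: hom_component_mult_form ideal.span_zero ideal.span_scale ideal.span_base)
  then show ?case using step(2) by (simp add: hom_component_add ideal.span_add)
qed


section \<open>Hilbert functions along a regular sequence\<close>

lemma span_insertE:
  fixes f :: "'a::comm_ring_1"
  assumes "p \<in> ideal.span (insert f S)"
  obtains i g where "i \<in> ideal.span S" "p = i + g * f"
proof -
  obtain k where "p - k * f \<in> ideal.span S"
    using assms ideal.span_breakdown_eq by blast
  then show ?thesis using that[of "p - k * f" k] by simp
qed

text \<open>
  Additivity of dimension along the exact sequence
  \<open>0 \<longrightarrow> (R/I)(-d) \<longrightarrow> R/I \<longrightarrow> R/(I + (f)) \<longrightarrow> 0\<close>, where \<open>I\<close> is the ideal generated by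
  \<open>S\<close>: a basis \<open>B\<close> of the component of \<open>R/(I + (f))\<close> in degree \<open>t\<close> together with \<open>f\<close> times
  a basis \<open>C\<close> of the component of \<open>R/I\<close> in degree \<open>t - d\<close> is a basis of the component of
  \<open>R/I\<close> in degree \<open>t\<close>. Homogeneity of \<open>I\<close> is needed for spanning: it allows the multiplier
  of \<open>f\<close> to be replaced by its component of degree \<open>t - d\<close>.
\<close>

lemma hilbert_function_insert:
  fixes f :: "('n::finite, 'k::field) mpoly"
  assumes S: "\<forall>s\<in>S. is_form s" and f: "f \<in> forms d"
    and nzd: "\<And>g. g * f \<in> ideal.span S \<Longrightarrow> g \<in> ideal.span S"
  shows "hilbert_function (ideal.span (insert f S)) t +
      (if d \<le> t then hilbert_function (ideal.span S) (t - d) else 0) =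
    hilbert_function (ideal.span S) t"
proof -
  let ?I = "ideal.span S" and ?K = "ideal.span (insert f S)"
  have I: "ideal.subspace ?I" and K: "ideal.subspace ?K" by simp_all
  have IK: "?I \<subseteq> ?K" by (rule ideal.span_mono) blast
  obtain B where B: "component_basis ?K t B" using component_basis_exists[OF K] by blast
  have finB: "finite B" and Bt: "B \<subseteq> forms t"
    and indB: "\<And>a b. (\<Sum>b\<in>B. pscale (a b) b) \<in> ?K \<Longrightarrow> b \<in> B \<Longrightarrow> a b = 0"
    and spnB: "\<And>p. p \<in> forms t \<Longrightarrow> \<exists>a. p - (\<Sum>b\<in>B. pscale (a b) b) \<in> ?K"
    using B by (simp_all add: component_basis_def)
  obtain C0 where C0: "component_basis ?I (t - d) C0" using component_basis_exists[OF I] by blast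
  \<comment> \<open>For \<open>t < d\<close> the subtraction \<open>t - d\<close> truncates to \<open>0\<close>, while the component of \<open>(R/I)(-d)\<close> is zero.\<close>
  define C where "C = (if d \<le> t then C0 else {})"
  have finC: "finite C" and Ct: "C \<subseteq> forms (t - d)"
    and indC: "\<And>a b. (\<Sum>b\<in>C. pscale (a b) b) \<in> ?I \<Longrightarrow> b \<in> C \<Longrightarrow> a b = 0"
    using C0 by (auto simp: component_basis_def C_def split: if_splits)
  have spnC: "\<exists>a. p - (\<Sum>b\<in>C. pscale (a b) b) \<in> ?I" if "p \<in> forms (t - d)" "d \<le> t" for p
    using C0 that by (simp add: component_basis_def C_def)
  have Cf: "c * f \<in> forms t" if "c \<in> C" for c
    using that Ct mult_in_forms[OF _ f, of c "t - d"] by (auto simp: C_def split: if_splits)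
  have pull: "(\<Sum>c\<in>C. pscale (a c) (c * f)) = (\<Sum>c\<in>C. pscale (a c) c) * f" for a
    unfolding sum_distrib_right pscale_def by (simp only: mult.assoc)
  have fK: "g * f \<in> ?K" for g
    by (intro ideal.span_scale ideal.span_base) simp
  have inj: "inj_on (\<lambda>c. c * f) C"
  proof
    fix c c' assume c: "c \<in> C" "c' \<in> C" "c * f = c' * f"
    show "c = c'"
    proof (rule ccontr)
      assume ne: "c \<noteq> c'"
      define a where "a x = (if x = c then 1 else if x = c' then - 1 else 0 :: 'k)" for x
      have "(c - c') * f \<in> ?I" using c(3) by (simp add: left_diff_distrib ideal.span_zero)
      then have "c - c' \<in> ?I" by (rule nzd)
      moreover have "(\<Sum>x\<in>C. pscale (a x) x) = (\<Sum>x\<in>{c, c'}. pscale (a x) x)"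
        using finC c by (intro sum.mono_neutral_right) (auto simp: a_def)
      ultimately have "(\<Sum>x\<in>C. pscale (a x) x) \<in> ?I" using ne by (simp add: a_def)
      then have "a c = 0" using indC c(1) by blast
      then show False by (simp add: a_def)
    qed
  qed
  have disj: "B \<inter> (\<lambda>c. c * f) ` C = {}"
  proof (rule ccontr)
    assume "B \<inter> (\<lambda>c. c * f) ` C \<noteq> {}"
    then obtain c where c: "c * f \<in> B" by blast
    have "(\<Sum>x\<in>B. pscale (if x = c * f then 1 else 0) x) = c * f"
      using c finB by (subst sum.remove[of _ "c * f"]) auto
    with indB[of "\<lambda>x. if x = c * f then 1 else 0" "c * f"] c fK show False by auto
  qed
  have split: "(\<Sum>b\<in>B \<union> (\<lambda>c. c * f) ` C. pscale (a b) b) =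
      (\<Sum>b\<in>B. pscale (a b) b) + (\<Sum>c\<in>C. pscale (a (c * f)) c) * f" for a
    using finB finC disj inj by (simp add: sum.union_disjoint sum.reindex flip: pull)
  have "component_basis ?I t (B \<union> (\<lambda>c. c * f) ` C)"
    unfolding component_basis_def
  proof (intro conjI allI impI ballI)
    fix a b assume s: "(\<Sum>b\<in>B \<union> (\<lambda>c. c * f) ` C. pscale (a b) b) \<in> ?I"
      and b: "b \<in> B \<union> (\<lambda>c. c * f) ` C"
    have "(\<Sum>b\<in>B. pscale (a b) b) + (\<Sum>c\<in>C. pscale (a (c * f)) c) * f \<in> ?K"
      using s IK unfolding split by blast
    from ideal.span_diff[OF this fK[of "\<Sum>c\<in>C. pscale (a (c * f)) c"]]
    have "(\<Sum>b\<in>B. pscale (a b) b) \<in> ?K" by simp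
    then have a0: "a b = 0" if "b \<in> B" for b using indB that by blast
    then have "(\<Sum>c\<in>C. pscale (a (c * f)) c) * f \<in> ?I" using s unfolding split by simp
    then have "(\<Sum>c\<in>C. pscale (a (c * f)) c) \<in> ?I" by (rule nzd)
    then have "a (c * f) = 0" if "c \<in> C" for c using indC[of "\<lambda>c. a (c * f)"] that by blast
    then show "a b = 0" using a0 b by blast
  next
    fix p :: "('n, 'k) mpoly" assume p: "p \<in> forms t"
    obtain a where "p - (\<Sum>b\<in>B. pscale (a b) b) \<in> ?K" using spnB[OF p] by blast
    then obtain i g where i: "i \<in> ?I" and ig: "p - (\<Sum>b\<in>B. pscale (a b) b) = i + g * f"
      by (rule span_insertE)
    have "p - (\<Sum>b\<in>B. pscale (a b) b) \<in> forms t"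
      using p Bt by (intro poly.subspace_diff poly.subspace_sum poly.subspace_scale subspace_forms) auto
    then have eq: "p - (\<Sum>b\<in>B. pscale (a b) b) =
        hom_component t i + (if d \<le> t then hom_component (t - d) g * f else 0)"
      by (subst hom_component_form[symmetric], assumption)
        (simp only: ig hom_component_add hom_component_mult_form[OF f])
    have it: "hom_component t i \<in> ?I" using hom_component_span[OF S i] .
    obtain e where e: "(if d \<le> t then hom_component (t - d) g * f else 0) -
        (\<Sum>c\<in>C. pscale (e c) c) * f \<in> ?I"
    proof (cases "d \<le> t")
      case True
      obtain e where "hom_component (t - d) g - (\<Sum>c\<in>C. pscale (e c) c) \<in> ?I"
        using spnC[OF hom_component_in_forms True] by blast
      then have "f * (hom_component (t - d) g - (\<Sum>c\<in>C. pscale (e c) c)) \<in> ?I"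
        by (rule ideal.span_scale)
      then show ?thesis using True that[of e] by (simp add: algebra_simps)
    next
      case False
      then show ?thesis using that[of "\<lambda>_. 0"] by (simp add: C_def ideal.span_zero)
    qed
    \<comment> \<open>Coefficients on \<open>B\<close> and on \<open>f * C\<close> are merged into one function on the union.\<close>
    define a' where "a' b = (if b \<in> B then a b else e (the_inv_into C (\<lambda>c. c * f) b))" for b
    have "(\<Sum>b\<in>B. pscale (a' b) b) = (\<Sum>b\<in>B. pscale (a b) b)" by (simp add: a'_def)
    moreover have "(\<Sum>c\<in>C. pscale (a' (c * f)) c) = (\<Sum>c\<in>C. pscale (e c) c)"
      using disj by (intro sum.cong) (auto simp: a'_def the_inv_into_f_f[OF inj])
    ultimately have "p - (\<Sum>b\<in>B \<union> (\<lambda>c. c * f) ` C. pscale (a' b) b) =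
        hom_component t i + ((if d \<le> t then hom_component (t - d) g * f else 0) -
        (\<Sum>c\<in>C. pscale (e c) c) * f)"
      unfolding split using eq by (simp add: algebra_simps)
    also have "\<dots> \<in> ?I" using it e by (rule ideal.span_add)
    finally show "\<exists>a. p - (\<Sum>b\<in>B \<union> (\<lambda>c. c * f) ` C. pscale (a b) b) \<in> ?I" by blast
  qed (use finB finC Bt Cf in auto)
  then have "hilbert_function ?I t = card (B \<union> (\<lambda>c. c * f) ` C)"
    by (rule hilbert_function_eq_card[OF I])
  also have "\<dots> = card B + card C"
    using finB finC disj inj by (simp add: card_Un_disjoint card_image)
  also have "card B = hilbert_function ?K t" using hilbert_function_eq_card[OF K B] by simp
  also have "card C = (if d \<le> t then hilbert_function ?I (t - d) else 0)"
    using hilbert_function_eq_card[OF I C0] by (simp add: C_def)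
  finally show ?thesis by simp
qed


section \<open>Monomial ideals\<close>

definition monomial_ideal :: "('n::finite \<Rightarrow>\<^sub>0 nat) set \<Rightarrow> ('n, 'k::field) mpoly set" where
  "monomial_ideal M = ideal.span ((\<lambda>m. Poly_Mapping.single m 1) ` M)"

text \<open>
  Divisibility of monomials is the pointwise order of their exponent functions.
\<close>

definition standard_monomials :: "('n::finite \<Rightarrow>\<^sub>0 nat) set \<Rightarrow> nat \<Rightarrow> ('n \<Rightarrow>\<^sub>0 nat) set" where
  "standard_monomials M t =
    {m. mdeg m = t \<and> (\<forall>u\<in>M. \<not> Poly_Mapping.lookup u \<le> Poly_Mapping.lookup m)}"

lemma inj_single_one: "inj (\<lambda>m. Poly_Mapping.single m (1 :: 'a::zero_neq_one))"
  by (rule injI) (metis keys_single one_neq_zero singleton_inject)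

lemma poly_mapping_eq_sum_single:
  "p = (\<Sum>m\<in>Poly_Mapping.keys p. Poly_Mapping.single m (Poly_Mapping.lookup p m))"
  by (rule poly_mapping_eqI)
    (auto simp: lookup_sum lookup_single when_def in_keys_iff)

lemma monomial_ideal_iff:
  fixes p :: "('n::finite, 'k::field) mpoly"
  shows "p \<in> monomial_ideal M \<longleftrightarrow>
    (\<forall>m\<in>Poly_Mapping.keys p. \<exists>u\<in>M. Poly_Mapping.lookup u \<le> Poly_Mapping.lookup m)"
    (is "_ \<longleftrightarrow> ?div p")
proof
  assume "p \<in> monomial_ideal M"
  then show "?div p"
    unfolding monomial_ideal_def
  proof (induction rule: ideal.span_induct_alt)
    case base
    show ?case by simp
  next
    case (step c x y)
    obtain u where u: "u \<in> M" "x = Poly_Mapping.single u 1" using step(1) by blast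
    show ?case
    proof
      fix m assume "m \<in> Poly_Mapping.keys (c * x + y)"
      then have "m \<in> Poly_Mapping.keys (c * x) \<or> m \<in> Poly_Mapping.keys y"
        using Poly_Mapping.keys_add[of "c * x" y] by blast
      then show "\<exists>u\<in>M. Poly_Mapping.lookup u \<le> Poly_Mapping.lookup m"
      proof
        assume "m \<in> Poly_Mapping.keys (c * x)"
        then obtain v where "m = v + u" using keys_mult[of c x] u(2) by auto
        then show ?thesis using u(1) by (intro bexI[of _ u]) (auto simp: le_fun_def lookup_add)
      next
        assume "m \<in> Poly_Mapping.keys y"
        then show ?thesis using step(2) by blast
      qed
    qed
  qed
next
  assume r: "?div p"
  have "Poly_Mapping.single m (Poly_Mapping.lookup p m) \<in> monomial_ideal M"
    if m: "m \<in> Poly_Mapping.keys p" for m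
  proof -
    obtain u where u: "u \<in> M" "Poly_Mapping.lookup u \<le> Poly_Mapping.lookup m" using r m by blast
    have "m = (m - u) + u"
      using u(2) by (intro poly_mapping_eqI) (simp add: lookup_add lookup_minus le_fun_def)
    then have "Poly_Mapping.single m (Poly_Mapping.lookup p m) =
        Poly_Mapping.single (m - u) (Poly_Mapping.lookup p m) * Poly_Mapping.single u 1"
      by (simp add: mult_single)
    also have "\<dots> \<in> monomial_ideal M"
      using u(1) unfolding monomial_ideal_def by (intro ideal.span_scale ideal.span_base) simp
    finally show ?thesis .
  qed
  then show "p \<in> monomial_ideal M"
    by (subst poly_mapping_eq_sum_single) (auto simp: monomial_ideal_def intro: ideal.span_sum)
qed

lemma hilbert_function_monomial_ideal:
  "hilbert_function (monomial_ideal M :: ('n::finite, 'k::field) mpoly set) t =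
    card (standard_monomials M t)"
proof -
  let ?I = "monomial_ideal M :: ('n, 'k) mpoly set" and ?N = "standard_monomials M t"
  let ?X = "\<lambda>m. Poly_Mapping.single m 1 :: ('n, 'k) mpoly"
  have fin: "finite ?N"
    by (rule finite_subset[OF _ finite_mdeg[of t]]) (auto simp: standard_monomials_def)
  have inj: "inj_on ?X ?N"
    by (rule inj_on_subset[OF inj_single_one]) simp
  have reindex: "(\<Sum>b\<in>?X ` ?N. pscale (a b) b) = (\<Sum>m\<in>?N. Poly_Mapping.single m (a (?X m)))" for a
    by (simp add: sum.reindex[OF inj] pscale_def mult_single)
  have coeff: "Poly_Mapping.lookup (\<Sum>m\<in>?N. Poly_Mapping.single m (e m)) m = (if m \<in> ?N then e m else 0)"
    for e and m :: "'n \<Rightarrow>\<^sub>0 nat"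
    using fin by (simp add: lookup_sum lookup_single when_def)
  have "component_basis ?I t (?X ` ?N)"
    unfolding component_basis_def
  proof (intro conjI allI impI ballI)
    show "?X ` ?N \<subseteq> forms t" by (auto simp: forms_def standard_monomials_def)
  next
    fix a b assume s: "(\<Sum>b\<in>?X ` ?N. pscale (a b) b) \<in> ?I" and "b \<in> ?X ` ?N"
    then obtain m where m: "m \<in> ?N" "b = ?X m" by blast
    show "a b = 0"
    proof (rule ccontr)
      assume "a b \<noteq> 0"
      then have "m \<in> Poly_Mapping.keys (\<Sum>b\<in>?X ` ?N. pscale (a b) b)"
        using m by (simp add: reindex coeff in_keys_iff)
      then show False using s m(1) by (auto simp: monomial_ideal_iff standard_monomials_def)
    qed
  next
    fix p :: "('n, 'k) mpoly" assume p: "p \<in> forms t"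
    define a where "a b = Poly_Mapping.lookup p (the_inv_into ?N ?X b)" for b
    have "(\<Sum>b\<in>?X ` ?N. pscale (a b) b) = (\<Sum>m\<in>?N. Poly_Mapping.single m (Poly_Mapping.lookup p m))"
      unfolding reindex by (rule sum.cong) (simp_all add: a_def the_inv_into_f_f[OF inj])
    then have nonstd: "Poly_Mapping.lookup p m \<noteq> 0 \<and> m \<notin> ?N"
      if "m \<in> Poly_Mapping.keys (p - (\<Sum>b\<in>?X ` ?N. pscale (a b) b))" for m
      using that by (auto simp: in_keys_iff lookup_minus coeff split: if_splits)
    have "p - (\<Sum>b\<in>?X ` ?N. pscale (a b) b) \<in> ?I"
      unfolding monomial_ideal_iff
    proof
      fix m assume "m \<in> Poly_Mapping.keys (p - (\<Sum>b\<in>?X ` ?N. pscale (a b) b))"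
      from nonstd[OF this] have "mdeg m = t" "m \<notin> ?N"
        using p by (auto simp: forms_def in_keys_iff)
      then show "\<exists>u\<in>M. Poly_Mapping.lookup u \<le> Poly_Mapping.lookup m"
        by (auto simp: standard_monomials_def)
    qed
    then show "\<exists>a. p - (\<Sum>b\<in>?X ` ?N. pscale (a b) b) \<in> ?I" by blast
  qed (simp add: fin)
  then have "hilbert_function ?I t = card (?X ` ?N)"
    by (rule hilbert_function_eq_card[rotated]) (simp add: monomial_ideal_def)
  then show ?thesis by (simp add: card_image[OF inj])
qed

text \<open>
  An element of a monomial ideal has all its monomials divisible by generators. So a generator
  that no other generator divides lies outside the ideal generated by the others.
\<close>

lemma monomial_ideal_minimal_generators:
  fixes M :: "('n::finite \<Rightarrow>\<^sub>0 nat) set"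
  assumes anti: "\<And>u v. u \<in> M \<Longrightarrow> v \<in> M \<Longrightarrow> Poly_Mapping.lookup u \<le> Poly_Mapping.lookup v \<Longrightarrow> u = v"
    and G': "G' \<subset> (\<lambda>m. Poly_Mapping.single m 1) ` M"
  shows "ideal.span G' \<noteq> (monomial_ideal M :: ('n, 'k::field) mpoly set)"
proof -
  let ?X = "\<lambda>m. Poly_Mapping.single m 1 :: ('n, 'k) mpoly"
  obtain N where N: "N \<subseteq> M" "G' = ?X ` N" using G' by (meson psubset_imp_subset subset_imageE)
  obtain v where v: "v \<in> M" "v \<notin> N" using N G' by blast
  then have "?X v \<notin> monomial_ideal N" using N(1) anti by (auto simp: monomial_ideal_iff)
  moreover have "?X v \<in> monomial_ideal M" using v by (auto simp: monomial_ideal_iff)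
  ultimately show ?thesis using N(2) by (auto simp: monomial_ideal_def)
qed


section \<open>The Hilbert function of a complete intersection\<close>

definition box_monomials :: "('n::finite \<Rightarrow> nat) \<Rightarrow> 'n set \<Rightarrow> nat \<Rightarrow> ('n \<Rightarrow>\<^sub>0 nat) set" where
  "box_monomials D S t = {m. mdeg m = t \<and> (\<forall>i\<in>S. Poly_Mapping.lookup m i < D i)}"

lemma finite_box_monomials: "finite (box_monomials D S t)"
  by (rule finite_subset[OF _ finite_mdeg[of t]]) (auto simp: box_monomials_def)

lemma mdeg_single: "mdeg (Poly_Mapping.single i e) = e"
  by (simp add: mdeg_def lookup_single when_def)

text \<open>
  The monomials that violate the new bound are those divisible by \<open>x\<^sub>j ^ D j\<close>, and division by
  this power identifies them with the monomials of degree \<open>t - D j\<close> that obey the old bounds.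
\<close>

lemma card_box_monomials_insert:
  assumes j: "j \<notin> S"
  shows "card (box_monomials D (insert j S) t) +
      (if D j \<le> t then card (box_monomials D S (t - D j)) else 0) = card (box_monomials D S t)"
proof -
  let ?h = "\<lambda>m. m + Poly_Mapping.single j (D j)"
  define C where "C = (if D j \<le> t then box_monomials D S (t - D j) else {})"
  have finC: "finite C" by (simp add: C_def finite_box_monomials)
  have "box_monomials D S t = box_monomials D (insert j S) t \<union> ?h ` C"
  proof (intro equalityI subsetI)
    fix m assume m: "m \<in> box_monomials D S t"
    show "m \<in> box_monomials D (insert j S) t \<union> ?h ` C"
    proof (cases "Poly_Mapping.lookup m j < D j")
      case True
      then show ?thesis using m by (simp add: box_monomials_def)
    next
      case False
      let ?v = "m - Poly_Mapping.single j (D j)"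
      have mv: "m = ?h ?v"
        using False by (intro poly_mapping_eqI) (auto simp: lookup_add lookup_minus lookup_single when_def)
      then have "mdeg m = mdeg ?v + D j" by (metis mdeg_add mdeg_single)
      moreover have "Poly_Mapping.lookup ?v i \<le> Poly_Mapping.lookup m i" for i
        by (simp add: lookup_minus)
      ultimately have "?v \<in> C"
        using m by (auto simp: C_def box_monomials_def intro: le_less_trans)
      then show ?thesis using mv by blast
    qed
  next
    fix m assume "m \<in> box_monomials D (insert j S) t \<union> ?h ` C"
    then show "m \<in> box_monomials D S t"
      using j by (auto simp: C_def box_monomials_def mdeg_add mdeg_single lookup_add lookup_single
          when_def split: if_splits)
  qed
  moreover have "box_monomials D (insert j S) t \<inter> ?h ` C = {}"
    by (auto simp: box_monomials_def lookup_add)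
  moreover have "card (?h ` C) = card C" by (rule card_image) (simp add: inj_on_def)
  ultimately have "card (box_monomials D S t) = card (box_monomials D (insert j S) t) + card C"
    using finC by (simp add: card_Un_disjoint finite_box_monomials)
  then show ?thesis by (simp add: C_def)
qed

text \<open>
  The map \<open>\<sigma>\<close> attaches a variable to each member of the sequence. Each initial part of
  the sequence and the box that is bounded in the variables attached to it satisfy the same
  recursion, and both start from the whole polynomial ring.
\<close>

lemma hilbert_function_regular_sequence:
  fixes fs :: "('n::finite, 'k::field) mpoly list" and \<sigma> :: "nat \<Rightarrow> 'n"
  assumes reg: "regular_sequence fs" and inj: "inj_on \<sigma> {..<length fs}"
    and D: "\<And>i. i < length fs \<Longrightarrow> fs ! i \<in> forms (D (\<sigma> i))"
  shows "hilbert_function (ideal.span (set fs)) t = card (box_monomials D (\<sigma> ` {..<length fs}) t)"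
proof -
  have "hilbert_function (ideal.span (set (take k fs))) t = card (box_monomials D (\<sigma> ` {..<k}) t)"
    if "k \<le> length fs" for k t
    using that
  proof (induction k arbitrary: t)
    case 0
    have "hilbert_function (monomial_ideal {} :: ('n, 'k) mpoly set) t = card (box_monomials D {} t)"
      by (simp only: hilbert_function_monomial_ideal) (simp add: standard_monomials_def box_monomials_def)
    then show ?case by (simp add: monomial_ideal_def)
  next
    case (Suc k)
    have k: "k < length fs" using Suc.prems by simp
    have forms: "\<forall>s\<in>set (take k fs). is_form s"
      using D by (metis in_set_conv_nth in_set_takeD is_form_def)
    have nzd: "\<And>g. g * fs ! k \<in> ideal.span (set (take k fs)) \<Longrightarrow> g \<in> ideal.span (set (take k fs))"
      using reg k by (auto simp: regular_sequence_def)
    have "\<sigma> k \<notin> \<sigma> ` {..<k}" 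
    proof
      assume "\<sigma> k \<in> \<sigma> ` {..<k}"
      then obtain i where "i < k" "\<sigma> k = \<sigma> i" by blast
      with inj_onD[OF inj, of k i] k show False by simp
    qed
    then have "card (box_monomials D (\<sigma> ` {..<Suc k}) t) +
      (if D (\<sigma> k) \<le> t then card (box_monomials D (\<sigma> ` {..<k}) (t - D (\<sigma> k))) else 0) =
        card (box_monomials D (\<sigma> ` {..<k}) t)"
      using card_box_monomials_insert[of "\<sigma> k" "\<sigma> ` {..<k}" D t] by (simp add: lessThan_Suc)
    moreover have "hilbert_function (ideal.span (set (take (Suc k) fs))) t +
      (if D (\<sigma> k) \<le> t then hilbert_function (ideal.span (set (take k fs))) (t - D (\<sigma> k)) else 0) =
        hilbert_function (ideal.span (set (take k fs))) t"
      using hilbert_function_insert[OF forms D[OF k] nzd, of t] k by (simp add: take_Suc_conv_app_nth)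
    ultimately show ?case using Suc.IH k by (simp split: if_splits)
  qed
  from this[of "length fs" t] show ?thesis by simp
qed

text \<open>
  In degree one only the variables \<open>i\<close> with \<open>D i \<ge> 2\<close> belong to the box; this is where the
  full codimension of the algebra enters.
\<close>

lemma two_le_degree:
  fixes D :: "'n::finite \<Rightarrow> nat"
  assumes "card (box_monomials D UNIV 1) = CARD('n)"
  shows "D j \<ge> 2"
proof (rule ccontr)
  assume j: "\<not> D j \<ge> 2"
  have "m \<in> (\<lambda>i. Poly_Mapping.single i 1) ` (UNIV - {j})" if m: "m \<in> box_monomials D UNIV 1" for m
  proof -
    have deg: "mdeg m = 1" and b: "\<And>i. Poly_Mapping.lookup m i < D i"
      using m by (auto simp: box_monomials_def)
    obtain i where i: "Poly_Mapping.lookup m i \<noteq> 0"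
      using deg unfolding mdeg_def by (metis sum.neutral zero_neq_one)
    have "mdeg m = Poly_Mapping.lookup m i + (\<Sum>k\<in>UNIV - {i}. Poly_Mapping.lookup m k)"
      unfolding mdeg_def by (rule sum.remove) auto
    then have li: "Poly_Mapping.lookup m i = 1" and "(\<Sum>k\<in>UNIV - {i}. Poly_Mapping.lookup m k) = 0"
      using deg i by linarith+
    then have "m = Poly_Mapping.single i 1"
      by (intro poly_mapping_eqI) (auto simp: lookup_single when_def)
    moreover have "i \<noteq> j" using b[of i] j li by auto
    ultimately show ?thesis by blast
  qed
  then have "card (box_monomials D UNIV 1) \<le> card ((\<lambda>i::'n. Poly_Mapping.single i (1::nat)) ` (UNIV - {j}))"
    by (intro card_mono) auto
  also have "\<dots> \<le> card (UNIV - {j})" by (rule card_image_le) simp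
  also have "\<dots> < CARD('n)" by (rule psubset_card_mono) auto
  finally show False using assms by simp
qed


section \<open>Artinian quotients\<close>

lemma forms_subset_of_hilbert_function_0:
  fixes I :: "('n::finite, 'k::field) mpoly set"
  assumes I: "ideal.subspace I" and "hilbert_function I d = 0"
  shows "forms d \<subseteq> I"
proof -
  obtain B where B: "component_basis I d B" using component_basis_exists[OF I] by blast
  then have "B = {}" using hilbert_function_eq_card[OF I B] assms(2) by (auto simp: component_basis_def)
  then show ?thesis using B by (auto simp: component_basis_def)
qed

text \<open>
  An ideal containing \<open>I\<close> contains all forms of degree at least \<open>L\<close>, so it is determined by its
  intersection with the space of polynomials of degree below \<open>L\<close>. That space has
  finite dimension, so these intersections stabilise along a descending chain.
\<close>

lemma artinian_quotient_if_cofinite_forms: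
  fixes I :: "('n::finite, 'k::field) mpoly set"
  assumes L: "\<And>d. L \<le> d \<Longrightarrow> forms d \<subseteq> I"
  shows "artinian_quotient I"
  unfolding artinian_quotient_def
proof (intro allI impI)
  fix J :: "nat \<Rightarrow> ('n, 'k) mpoly set"
  assume J: "\<forall>i. ideal.subspace (J i) \<and> I \<subseteq> J i \<and> J (Suc i) \<subseteq> J i"
  define E where "E = (\<lambda>m. Poly_Mapping.single m (1::'k)) ` {m :: 'n \<Rightarrow>\<^sub>0 nat. mdeg m < L}"
  have "{m :: 'n \<Rightarrow>\<^sub>0 nat. mdeg m < L} = (\<Union>d<L. {m. mdeg m = d})" by auto
  then have finE: "finite E" by (simp add: E_def finite_mdeg)
  define W where "W i = J i \<inter> poly.span E" for i
  have sJ: "poly.subspace (J i)" for i using J ideal_imp_poly_subspace by blast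
  have sW: "poly.subspace (W i)" for i
    unfolding W_def by (intro poly.subspace_inter sJ poly.subspace_span)
  have decJ: "J j \<subseteq> J i" if "i \<le> j" for i j
    using that by (rule lift_Suc_antimono_le[rotated]) (use J in blast)
  \<comment> \<open>The chain is constant from an index on where the dimension of the intersection is minimal.\<close>
  obtain N where N: "\<And>i. poly.dim (W N) \<le> poly.dim (W i)"
    using ex_has_least_nat[of "\<lambda>_. True" 0 "\<lambda>i. poly.dim (W i)"] by auto
  have "J i = J N" if i: "N \<le> i" for i
  proof
    show "J i \<subseteq> J N" by (rule decJ[OF i])
    then have WN: "W i \<subseteq> W N" by (auto simp: W_def)
    obtain B where B: "B \<subseteq> W i" "poly.independent B" "W i \<subseteq> poly.span B" "card B = poly.dim (W i)"
      using poly.basis_exists by blast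
    obtain C where C: "B \<subseteq> C" "C \<subseteq> W N" "poly.independent C" "W N \<subseteq> poly.span C"
      using poly.maximal_independent_subset_extend[of B "W N"] B WN by blast
    have "C \<subseteq> poly.span E" using C(2) by (auto simp: W_def)
    then have "finite C" using poly.independent_span_bound[OF finE C(3)] by simp
    moreover have "card C \<le> card B" using poly.basis_card_eq_dim[OF C(2,4,3)] B(4) N[of i] by simp
    ultimately have "B = C" using C(1) by (metis card_seteq)
    then have "W N \<subseteq> poly.span B" using C(4) by simp
    also have "\<dots> \<subseteq> W i" using B(1) sW by (rule poly.span_minimal)
    finally have W: "W N \<subseteq> W i" .
    show "J N \<subseteq> J i"
    proof
      fix p assume p: "p \<in> J N"
      let ?s = "\<lambda>A. \<Sum>m\<in>A. Poly_Mapping.single m (Poly_Mapping.lookup p m)"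
      define q where "q = ?s {m \<in> Poly_Mapping.keys p. mdeg m < L}"
      define r where "r = ?s {m \<in> Poly_Mapping.keys p. \<not> mdeg m < L}"
      have "p = q + r"
        unfolding q_def r_def
        by (subst poly_mapping_eq_sum_single, subst sum.union_disjoint[symmetric])
          (auto intro!: arg_cong2[where f=sum])
      have "Poly_Mapping.single m (Poly_Mapping.lookup p m) \<in> J i" if "\<not> mdeg m < L" for m
      proof -
        have "Poly_Mapping.single m (Poly_Mapping.lookup p m) \<in> forms (mdeg m)" by (simp add: forms_def)
        then show ?thesis using L[of "mdeg m"] that J by auto
      qed
      then have r: "r \<in> J i" unfolding r_def by (intro poly.subspace_sum[OF sJ]) auto
      have "Poly_Mapping.single m (Poly_Mapping.lookup p m) \<in> poly.span E" if "mdeg m < L" for m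
      proof -
        have "Poly_Mapping.single m (Poly_Mapping.lookup p m) =
            pscale (Poly_Mapping.lookup p m) (Poly_Mapping.single m 1)"
          by (simp add: pscale_def mult_single)
        also have "\<dots> \<in> poly.span E"
          using that by (intro poly.span_scale poly.span_base) (simp add: E_def)
        finally show ?thesis .
      qed
      then have "q \<in> poly.span E" unfolding q_def by (intro poly.span_sum) auto
      moreover have "q \<in> J N"
        using poly.subspace_diff[OF sJ p, of r] r decJ[OF i] \<open>p = q + r\<close> by auto
      ultimately have "q \<in> J i" using W by (auto simp: W_def)
      then show "p \<in> J i" using r \<open>p = q + r\<close> poly.subspace_add[OF sJ] by blast
    qed
  qed
  then show "\<exists>N. \<forall>i\<ge>N. J i = J N" by blast
qed


section \<open>The almost complete intersection\<close>

text \<open>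
  With \<open>a = D x\<close> and \<open>b = D y\<close>, these are the exponents of \<open>x^(a-1) y^(b+1-a)\<close>,
  \<open>y^(b+1)\<close> and the pure powers \<open>z^(D z)\<close> of all variables \<open>z \<noteq> y\<close>. In
  terms of resolutions over \<open>k[x, y]\<close>, for \<open>2 \<le> a \<le> b\<close>: compared with \<open>(x^a, y^b)\<close>, the
  three monomials in \<open>x\<close> and \<open>y\<close> have one more generator degree and one more syzygy degree, both
  equal to \<open>b + 1\<close>, and these cancel in the Hilbert series.
\<close>

definition aci_exponents :: "('n::finite \<Rightarrow> nat) \<Rightarrow> 'n \<Rightarrow> 'n \<Rightarrow> ('n \<Rightarrow>\<^sub>0 nat) set" where
  "aci_exponents D x y =
    insert (Poly_Mapping.single x (D x - 1) + Poly_Mapping.single y (D y + 1 - D x))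
      ((\<lambda>i. Poly_Mapping.single i ((D(y := D y + 1)) i)) ` UNIV)"

lemma lookup_single_le_iff:
  fixes m :: "'n \<Rightarrow>\<^sub>0 nat"
  shows "Poly_Mapping.lookup (Poly_Mapping.single i e) \<le> Poly_Mapping.lookup m \<longleftrightarrow> e \<le> Poly_Mapping.lookup m i"
  unfolding le_fun_def lookup_single when_def by auto

context
  fixes D :: "'n::finite \<Rightarrow> nat" and x y :: 'n
  assumes xy: "x \<noteq> y" and le: "D x \<le> D y" and ge2: "\<And>i. 2 \<le> D i"
begin

lemma mixed_le_iff:
  fixes m :: "'n \<Rightarrow>\<^sub>0 nat"
  shows "Poly_Mapping.lookup (Poly_Mapping.single x e + Poly_Mapping.single y f) \<le> Poly_Mapping.lookup m \<longleftrightarrow>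
    e \<le> Poly_Mapping.lookup m x \<and> f \<le> Poly_Mapping.lookup m y"
proof -
  have "Poly_Mapping.lookup (Poly_Mapping.single x e + Poly_Mapping.single y f) i =
      (if i = x then e else if i = y then f else 0)" for i
    using xy by (simp add: lookup_add lookup_single when_def)
  then show ?thesis using xy unfolding le_fun_def by (metis le0)
qed

lemma aci_exponents_antichain:
  assumes "u \<in> aci_exponents D x y" "v \<in> aci_exponents D x y"
    and "Poly_Mapping.lookup u \<le> Poly_Mapping.lookup v"
  shows "u = v"
proof -
  let ?w = "Poly_Mapping.single x (D x - 1) + Poly_Mapping.single y (D y + 1 - D x)"
  let ?E = "D(y := D y + 1)"
  have lw: "Poly_Mapping.lookup ?w i = (if i = x then D x - 1 else if i = y then D y + 1 - D x else 0)" for i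
    using xy by (simp add: lookup_add lookup_single when_def)
  have pos: "0 < ?E i" for i using ge2[of i] by simp
  consider "u = ?w" "v = ?w"
    | j where "u = ?w" "v = Poly_Mapping.single j (?E j)"
    | i where "u = Poly_Mapping.single i (?E i)" "v = ?w"
    | i j where "u = Poly_Mapping.single i (?E i)" "v = Poly_Mapping.single j (?E j)"
    using assms(1,2) unfolding aci_exponents_def by blast
  then show ?thesis
  proof cases
    case 1
    then show ?thesis by simp
  next
    case (2 j)
    have "D x - 1 \<le> Poly_Mapping.lookup v x" "D y + 1 - D x \<le> Poly_Mapping.lookup v y"
      using assms(3) unfolding 2(1) mixed_le_iff by blast+
    then have "0 < Poly_Mapping.lookup v x" "0 < Poly_Mapping.lookup v y"
      using ge2[of x] le by linarith+
    then show ?thesis using xy by (auto simp: 2(2) lookup_single when_def split: if_splits)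
  next
    case (3 i)
    have "?E i \<le> Poly_Mapping.lookup ?w i"
      using assms(3) unfolding 3 lookup_single_le_iff .
    then show ?thesis using xy le ge2[of x] ge2[of i] unfolding lw by (auto split: if_splits)
  next
    case (4 i j)
    have "?E i \<le> Poly_Mapping.lookup v i"
      using assms(3) unfolding 4(1) lookup_single_le_iff .
    then have "0 < Poly_Mapping.lookup v i" using pos[of i] by linarith
    then have "i = j" unfolding 4(2) lookup_single when_def by (auto split: if_splits)
    then show ?thesis using 4 by simp
  qed
qed

lemma card_aci_exponents: "card (aci_exponents D x y) = CARD('n) + 1"
proof -
  let ?E = "D(y := D y + 1)"
  let ?P = "(\<lambda>i. Poly_Mapping.single i (?E i)) ` UNIV"
  have pos: "0 < ?E i" for i using ge2[of i] by simp
  have "inj (\<lambda>i. Poly_Mapping.single i (?E i))"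
  proof (rule injI)
    fix i j
    assume eq: "Poly_Mapping.single i (?E i) = Poly_Mapping.single j (?E j)"
    have "0 < Poly_Mapping.lookup (Poly_Mapping.single j (?E j)) i"
      unfolding eq[symmetric] lookup_single_eq by (rule pos)
    then show "i = j" unfolding lookup_single when_def by (auto split: if_splits)
  qed
  then have "card ?P = CARD('n)" by (rule card_image)
  moreover have "Poly_Mapping.single x (D x - 1) + Poly_Mapping.single y (D y + 1 - D x) \<notin> ?P"
  proof
    assume "Poly_Mapping.single x (D x - 1) + Poly_Mapping.single y (D y + 1 - D x) \<in> ?P"
    then obtain i where i: "Poly_Mapping.single x (D x - 1) + Poly_Mapping.single y (D y + 1 - D x) =
      Poly_Mapping.single i (?E i)" by blast
    show False
      using arg_cong[OF i, of "\<lambda>m. Poly_Mapping.lookup m x"] arg_cong[OF i, of "\<lambda>m. Poly_Mapping.lookup m y"]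
        xy le ge2[of x]
      by (auto simp: lookup_add lookup_single when_def split: if_splits)
  qed
  ultimately show ?thesis by (simp add: aci_exponents_def)
qed

lemma standard_monomials_aci:
  "standard_monomials (aci_exponents D x y) t =
    {m. mdeg m = t \<and> (\<forall>i. Poly_Mapping.lookup m i < (D(y := D y + 1)) i) \<and>
      \<not> (D x - 1 \<le> Poly_Mapping.lookup m x \<and> D y + 1 - D x \<le> Poly_Mapping.lookup m y)}"
  unfolding standard_monomials_def aci_exponents_def
  by (auto simp del: fun_upd_apply simp: lookup_single_le_iff mixed_le_iff not_le)

lemma mdeg_remove2:
  "mdeg m = Poly_Mapping.lookup m x + Poly_Mapping.lookup m y + (\<Sum>i\<in>UNIV - {x, y}. Poly_Mapping.lookup m i)"
proof -
  have "mdeg m = (\<Sum>i\<in>{x, y}. Poly_Mapping.lookup m i) + (\<Sum>i\<in>UNIV - {x, y}. Poly_Mapping.lookup m i)"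
    unfolding mdeg_def by (subst add.commute, rule sum.subset_diff) auto
  then show ?thesis using xy by simp
qed

text \<open>
  The monomials of the box that the mixed generator divides have exponent \<open>D x - 1\<close>
  at \<open>x\<close> and exponent \<open>D y + 1 - D x + i\<close> at \<open>y\<close>, with \<open>i < D x - 1\<close>. The standard monomials
  outside the box have exponent \<open>i < D x - 1\<close> at \<open>x\<close> and exponent \<open>D y\<close> at \<open>y\<close>. Matching
  equal \<open>i\<close> and leaving the other variables alone preserves the degree, because
  \<open>(D x - 1) + (D y + 1 - D x + i) = i + D y\<close>.
\<close>

lemma card_standard_monomials_aci:
  "card (standard_monomials (aci_exponents D x y) t) = card (box_monomials D UNIV t)"
proof -
  let ?A = "box_monomials D UNIV t" and ?B = "standard_monomials (aci_exponents D x y) t"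
  define set2 where "set2 i j m = Poly_Mapping.update x i (Poly_Mapping.update y j m)"
    for i j and m :: "'n \<Rightarrow>\<^sub>0 nat"
  have lk: "Poly_Mapping.lookup (set2 i j m) k =
      (if k = x then i else if k = y then j else Poly_Mapping.lookup m k)" for i j m k
    by (simp add: set2_def lookup_update)
  have deg: "mdeg (set2 i j m) + Poly_Mapping.lookup m x + Poly_Mapping.lookup m y = mdeg m + i + j" for i j m
    using xy by (simp add: mdeg_remove2 lk)
  define \<phi> where "\<phi> m = set2 (Poly_Mapping.lookup m y - (D y + 1 - D x)) (D y) m" for m
  define \<psi> where "\<psi> m = set2 (D x - 1) (Poly_Mapping.lookup m x + (D y + 1 - D x)) m" for m
  have A: "m \<in> ?A - ?B \<longleftrightarrow> mdeg m = t \<and> Poly_Mapping.lookup m x = D x - 1 \<and>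
      D y + 1 - D x \<le> Poly_Mapping.lookup m y \<and> Poly_Mapping.lookup m y < D y \<and>
      (\<forall>i\<in>UNIV - {x, y}. Poly_Mapping.lookup m i < D i)" (is "_ \<longleftrightarrow> ?a m") for m
  proof
    assume m: "m \<in> ?A - ?B"
    then have "\<And>i. Poly_Mapping.lookup m i < D i" by (auto simp: box_monomials_def)
    moreover from this have "\<And>i. Poly_Mapping.lookup m i < (D(y := D y + 1)) i"
      by (simp add: less_SucI)
    ultimately show "?a m" using m ge2[of x]
      by (auto simp: box_monomials_def standard_monomials_aci intro!: le_antisym less_Suc_eq_le[THEN iffD1])
  next
    assume m: "?a m"
    then have "Poly_Mapping.lookup m i < D i" for i
      using ge2[of x] by (cases "i = x"; cases "i = y") auto
    then show "m \<in> ?A - ?B" using m by (auto simp: box_monomials_def standard_monomials_aci)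
  qed
  have B: "m \<in> ?B - ?A \<longleftrightarrow> mdeg m = t \<and> Poly_Mapping.lookup m x < D x - 1 \<and>
      Poly_Mapping.lookup m y = D y \<and>
      (\<forall>i\<in>UNIV - {x, y}. Poly_Mapping.lookup m i < D i)" (is "_ \<longleftrightarrow> ?b m") for m
  proof
    assume m: "m \<in> ?B - ?A"
    then have *: "\<And>i. Poly_Mapping.lookup m i < (D(y := D y + 1)) i" "mdeg m = t"
      "\<not> (D x - 1 \<le> Poly_Mapping.lookup m x \<and> D y + 1 - D x \<le> Poly_Mapping.lookup m y)"
      by (auto simp: standard_monomials_aci simp del: fun_upd_apply)
    then have o: "i \<noteq> y \<Longrightarrow> Poly_Mapping.lookup m i < D i" for i by (metis fun_upd_other)
    then have "\<not> Poly_Mapping.lookup m y < D y" using m *(2) by (auto simp: box_monomials_def) metis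
    then have "Poly_Mapping.lookup m y = D y" using *(1)[of y] by simp
    then show "?b m" using * o ge2[of x] by auto
  next
    assume m: "?b m"
    then have "Poly_Mapping.lookup m i < (D(y := D y + 1)) i" for i
      by (cases "i = x"; cases "i = y") auto
    then show "m \<in> ?B - ?A"
      using m by (auto simp: box_monomials_def standard_monomials_aci intro!: exI[of _ y])
  qed
  have "bij_betw \<phi> (?A - ?B) (?B - ?A)"
  proof (rule bij_betw_byWitness[where f' = \<psi>])
    show "\<forall>m\<in>?A - ?B. \<psi> (\<phi> m) = m"
    proof
      fix m assume "m \<in> ?A - ?B"
      then have "Poly_Mapping.lookup (\<psi> (\<phi> m)) i = Poly_Mapping.lookup m i" for i
        unfolding A using xy by (auto simp: \<phi>_def \<psi>_def lk)
      then show "\<psi> (\<phi> m) = m" by (rule poly_mapping_eqI)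
    qed
    show "\<forall>m\<in>?B - ?A. \<phi> (\<psi> m) = m"
    proof
      fix m assume "m \<in> ?B - ?A"
      then have "Poly_Mapping.lookup (\<phi> (\<psi> m)) i = Poly_Mapping.lookup m i" for i
        unfolding B using xy by (auto simp: \<phi>_def \<psi>_def lk)
      then show "\<phi> (\<psi> m) = m" by (rule poly_mapping_eqI)
    qed
    show "\<phi> ` (?A - ?B) \<subseteq> ?B - ?A"
    proof
      fix m' assume "m' \<in> \<phi> ` (?A - ?B)"
      then obtain m where m: "m \<in> ?A - ?B" "m' = \<phi> m" by blast
      then show "m' \<in> ?B - ?A"
        using deg[of "Poly_Mapping.lookup m y - (D y + 1 - D x)" "D y" m] le ge2[of x] xy
        unfolding A B by (auto simp: \<phi>_def lk)
    qed
    show "\<psi> ` (?B - ?A) \<subseteq> ?A - ?B"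
    proof
      fix m' assume "m' \<in> \<psi> ` (?B - ?A)"
      then obtain m where m: "m \<in> ?B - ?A" "m' = \<psi> m" by blast
      then show "m' \<in> ?A - ?B"
        using deg[of "D x - 1" "Poly_Mapping.lookup m x + (D y + 1 - D x)" m] le ge2[of x] xy
        unfolding A B by (auto simp: \<psi>_def lk)
    qed
  qed
  then have "card (?A - ?B) = card (?B - ?A)" by (rule bij_betw_same_card)
  moreover have "finite ?B"
    by (rule finite_subset[OF _ finite_mdeg[of t]]) (auto simp: standard_monomials_def)
  ultimately show ?thesis
    using card_Int_Diff[of ?A ?B] card_Int_Diff[of ?B ?A] finite_box_monomials[of D UNIV t]
    by (simp add: Int_commute)
qed

end

theorem proposition3p2:
  fixes H :: "nat list"
  assumes "infinite (UNIV :: 'k::field set)"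
    and "CARD('n::finite) \<ge> 3"
    and "CI_sequence TYPE('k) TYPE('n) H"
  shows "ACI_sequence TYPE('k) TYPE('n) H"
proof -
  obtain I :: "('n, 'k) mpoly set" and fs where
    pos: "\<forall>h\<in>set H. h > 0" and HI: "has_hilbert_sequence I H"
    and h1: "hilbert_function I 1 = CARD('n)"
    and len: "length fs = CARD('n)" and forms: "\<forall>f\<in>set fs. is_form f"
    and reg: "regular_sequence fs" and I: "I = ideal.span (set fs)"
    using assms(3) unfolding CI_sequence_def complete_intersection_def artinian_algebra_full_codim_def
    by blast
  obtain \<sigma> :: "nat \<Rightarrow> 'n" where \<sigma>: "bij_betw \<sigma> {..<length fs} UNIV"
    using ex_bij_betw_nat_finite[of "UNIV :: 'n set"] len by (auto simp: atLeast0LessThan)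
  have "\<forall>i<length fs. \<exists>d. fs ! i \<in> forms d" using forms by (simp add: is_form_def)
  then obtain deg where deg: "\<And>i. i < length fs \<Longrightarrow> fs ! i \<in> forms (deg i)" by metis
  define D where "D j = deg (the_inv_into {..<length fs} \<sigma> j)" for j
  have D: "fs ! i \<in> forms (D (\<sigma> i))" if "i < length fs" for i
    using that deg by (simp add: D_def the_inv_into_f_f[OF bij_betw_imp_inj_on[OF \<sigma>]])
  have HFI: "hilbert_function I t = card (box_monomials D UNIV t)" for t
    using hilbert_function_regular_sequence[OF reg bij_betw_imp_inj_on[OF \<sigma>] D, of t]
      bij_betw_imp_surj_on[OF \<sigma>] I by simp
  have ge2: "2 \<le> D i" for i using two_le_degree h1 HFI[of 1] by metis
  obtain x y :: 'n where xy: "x \<noteq> y" "D x \<le> D y"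
  proof -
    have "\<exists>x y :: 'n. x \<noteq> y"
    proof (rule ccontr)
      assume "\<nexists>x y :: 'n. x \<noteq> y"
      then have "card (UNIV :: 'n set) \<le> card {undefined :: 'n}" by (intro card_mono) auto
      then show False using assms(2) by simp
    qed
    then show ?thesis using that by (metis nle_le)
  qed
  define M where "M = aci_exponents D x y"
  define J :: "('n, 'k) mpoly set" where "J = monomial_ideal M"
  have J: "ideal.subspace J" by (simp add: J_def monomial_ideal_def)
  have HFJ: "hilbert_function J t = hilbert_function I t" for t
    unfolding HFI J_def M_def hilbert_function_monomial_ideal
    by (rule card_standard_monomials_aci[OF xy ge2])
  have HJ: "has_hilbert_sequence J H" using HI by (simp add: has_hilbert_sequence_def HFJ)
  have art: "artinian_quotient J"
  proof (rule artinian_quotient_if_cofinite_forms)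
    fix d assume "length H \<le> d"
    then have "hilbert_function J d = 0" using HJ by (simp add: has_hilbert_sequence_def)
    then show "forms d \<subseteq> J" by (rule forms_subset_of_hilbert_function_0[OF J])
  qed
  let ?G = "(\<lambda>m. Poly_Mapping.single m 1 :: ('n, 'k) mpoly) ` M"
  have cG: "card ?G = CARD('n) + 1"
    using card_aci_exponents[OF xy ge2] by (simp add: M_def card_image inj_on_subset[OF inj_single_one])
  moreover have "finite ?G" by (rule card_ge_0_finite) (simp add: cG)
  moreover have "\<forall>g\<in>?G. is_form g" by (auto simp: is_form_def forms_def)
  moreover have "\<forall>G'. G' \<subset> ?G \<longrightarrow> ideal.span G' \<noteq> J"
    using monomial_ideal_minimal_generators[OF aci_exponents_antichain[OF xy ge2]]
    unfolding J_def M_def by blast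
  moreover have "J = ideal.span ?G" by (simp add: J_def monomial_ideal_def)
  moreover have "hilbert_function J 1 = CARD('n)" using HFJ h1 by simp
  ultimately have "almost_complete_intersection J"
    unfolding almost_complete_intersection_def artinian_algebra_full_codim_def
    using art by blast
  then show ?thesis using pos HJ unfolding ACI_sequence_def by blast
qed

end
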